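(* Let $D$ be a principal ideal domain with quotient field $K$, and let $f\in\operatorname{Int}(D)=\{f\in K[x]\mid f(D)\subseteq D\}$ be non-constant and image-primitive, written in standard form as $$f=\frac{\prod_{i\in I}g_i}{\prod_{p\in T}p^{e_p}},$$ where $I\neq\emptyset$ is a finite set, for each $i\in I$ the polynomial $g_i\in D[x]$ is primitive and irreducible in $D[x]$, $T$ is a finite set of pairwise non-associated primes of $D$, and the $e_p$ ($p\in T$) are natural numbers. If the quintessential graph of $(g_i\mid i\in I)$ is connected, then $f$ is absolutely irreducible in $\operatorname{Int}(D)$.
   Context: A polynomial in $D[x]$ is primitive if the greatest common divisor of its coefficients is $1$. Standard form: a non-zero $f\in K[x]$ is written as $f=\frac{a\prod_{i\in I}g_i}{b}$ with $a,b\in D\setminus\{0\}$, $\gcd(a,b)=1$, $I$ a finite set, and each $g_i$ primitive and irreducible in $D[x]$ (the $g_i$ need not be distinct for distinct indices); $a$, $b$ and the numerator are unique only up to units of $D$, and for image-primitive $f$ one may take $a=1$. Fixed divisor: for $f\in\operatorname{Int}(D)$, $\mathsf d(f)$ is the ideal of $D$ generated by $f(D)$ (also identified with a generator of this ideal). $f\in\operatorname{Int}(D)$ is image-primitive if $\mathsf d(f)=D$. Quintessential: let $I\neq\emptyset$ be finite, $g_i\in D[x]$ ($i\in I$) non-constant and primitive, $g=\prod_{i\in I}g_i$, and $p\in D$ a prime element. $g_i$ is quintessential for $p$ among the $g_j$ with $j\in I$ if $p\mid\mathsf d(g)$ and there exists $w\in D$ such that $v_p(g_i(w))=v_p(\mathsf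 d(g))$ and $v_p(g_j(w))=0$ for all $j\in I\setminus\{i\}$, where $v_p$ is the $p$-adic valuation. Quintessential graph: for $g_i\in D[x]$ ($i\in I$) primitive and irreducible, the quintessential graph of $(g_i\mid i\in I)$ is the simple undirected graph with vertex set $I$ in which two (distinct) vertices $i,j$ are joined by an edge if and only if there is a prime element $p\in D$ such that both $g_i$ and $g_j$ are quintessential for $p$ among the $g_k$ with $k\in I$. Absolutely irreducible: in a commutative ring $R$ with identity, an element is irreducible if it is a non-zero non-unit that is not a product of two non-units; $r,s\in R$ are associated if $r=us$ for a unit $u$; two factorizations into irreducibles $a_1\cdots a_n=b_1\cdots b_m$ of the same element are essentially the same if $n=m$ and, after re-indexing, $a_j$ is associated to $b_j$ for all $j$. An irreducible $c\in R$ is absolutely irreducible if for all natural numbers $n$ every factorization of $c^n$ into irreducibles is essentially the same as $c^n=c\cdots c$. *)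

theory Defs
  imports
    "HOL-Computational_Algebra.Polynomial_Factorial"
    "HOL-Library.Extended_Nat"
    "HOL-Library.Multiset"
begin

text \<open>
  The domain \<open>D\<close> is the universe of a type of class \<^class>\<open>idom\<close>, and its quotient field \<open>K\<close>
  is the type of fractions over it, with embedding \<^const>\<open>to_fract\<close>.  A commutative ring is a
  module over itself by multiplication, so the ideals of \<open>D\<close> are exactly the \<open>(*)\<close>-subspaces
  and \<open>module.span (*) A\<close> is the ideal generated by \<open>A\<close>.
\<close>

definition principal_ideal_domain :: "'a::idom itself \<Rightarrow> bool" where
  "principal_ideal_domain _ \<longleftrightarrow>
     (\<forall>J :: 'a set. module.subspace (*) J \<longrightarrow> (\<exists>d. J = module.span (*) {d}))"

text \<open>Irreducibility and association relative to a subring \<open>R\<close> of the ambient ring.\<close>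

definition units_in :: "'b::comm_ring_1 set \<Rightarrow> 'b set" where
  "units_in R = {u \<in> R. \<exists>v\<in>R. u * v = 1}"

definition associated_in :: "'b::comm_ring_1 set \<Rightarrow> 'b \<Rightarrow> 'b \<Rightarrow> bool" where
  "associated_in R r s \<longleftrightarrow> (\<exists>u\<in>units_in R. r = u * s)"

definition irreducible_in :: "'b::comm_ring_1 set \<Rightarrow> 'b \<Rightarrow> bool" where
  "irreducible_in R c \<longleftrightarrow> c \<in> R \<and> c \<noteq> 0 \<and> c \<notin> units_in R \<and>
     (\<forall>a\<in>R. \<forall>b\<in>R. c = a * b \<longrightarrow> a \<in> units_in R \<or> b \<in> units_in R)"

text \<open>
  A factorization is the multiset of its factors; \<^const>\<open>rel_mset\<close> provides the re-indexing
  (and equality of the numbers of factors).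
\<close>

definition factorization_in :: "'b::comm_ring_1 set \<Rightarrow> 'b multiset \<Rightarrow> 'b \<Rightarrow> bool" where
  "factorization_in R A c \<longleftrightarrow> (\<forall>a\<in>#A. irreducible_in R a) \<and> prod_mset A = c"

definition essentially_same_in :: "'b::comm_ring_1 set \<Rightarrow> 'b multiset \<Rightarrow> 'b multiset \<Rightarrow> bool" where
  "essentially_same_in R = rel_mset (associated_in R)"

definition absolutely_irreducible_in :: "'b::comm_ring_1 set \<Rightarrow> 'b \<Rightarrow> bool" where
  "absolutely_irreducible_in R c \<longleftrightarrow> irreducible_in R c \<and>
     (\<forall>n A. factorization_in R A (c ^ n) \<longrightarrow> essentially_same_in R A (replicate_mset n c))"

definition int_valued :: "'a::idom fract poly set" where
  "int_valued = {f. \<forall>w. poly f (to_fract w) \<in> range to_fract}"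

definition fixed_divisor :: "'a::idom fract poly \<Rightarrow> 'a set" where
  "fixed_divisor f = module.span (*) {a. \<exists>w. poly f (to_fract w) = to_fract a}"

definition image_primitive :: "'a::idom fract poly \<Rightarrow> bool" where
  "image_primitive f \<longleftrightarrow> f \<in> int_valued \<and> fixed_divisor f = UNIV"

definition primitive_poly :: "'a::idom poly \<Rightarrow> bool" where
  "primitive_poly g \<longleftrightarrow> (\<forall>c. (\<forall>n. c dvd coeff g n) \<longrightarrow> c dvd 1)"

text \<open>
  The \<open>p\<close>-adic valuation with \<open>v\<^sub>p(0) = \<infinity>\<close>, in contrast to \<open>multiplicity p 0 = 0\<close>.
\<close>

definition pval :: "'a::idom \<Rightarrow> 'a \<Rightarrow> enat" where
  "pval p x = (SUP n\<in>{n. p ^ n dvd x}. enat n)"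

text \<open>
  \<open>g i\<close> is quintessential for \<open>p\<close> among the \<open>g j\<close> with \<open>j \<in> I\<close>.  Here \<open>d\<close> is a generator of the
  fixed divisor of the product; it is unique up to units, on which nothing below depends.
\<close>

definition quintessential :: "'i set \<Rightarrow> ('i \<Rightarrow> 'a::idom poly) \<Rightarrow> 'a \<Rightarrow> 'i \<Rightarrow> bool" where
  "quintessential I g p i \<longleftrightarrow>
     (\<exists>d. fixed_divisor (fract_poly (\<Prod>j\<in>I. g j)) = module.span (*) {d} \<and> p dvd d \<and>
       (\<exists>w. pval p (poly (g i) w) = pval p d \<and>
            (\<forall>j\<in>I - {i}. pval p (poly (g j) w) = 0)))"

text \<open>Edge relation of the quintessential graph on the vertex set \<open>I\<close>.\<close>

definition quintessential_edges :: "'i set \<Rightarrow> ('i \<Rightarrow> 'a::idom poly) \<Rightarrow> ('i \<times> 'i) set" where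
  "quintessential_edges I g = {(i, j). i \<in> I \<and> j \<in> I \<and> i \<noteq> j \<and>
     (\<exists>p. prime_elem p \<and> quintessential I g p i \<and> quintessential I g p j)}"

definition graph_connected :: "'i set \<Rightarrow> ('i \<times> 'i) set \<Rightarrow> bool" where
  "graph_connected V E \<longleftrightarrow> V \<noteq> {} \<and> (\<forall>i\<in>V. \<forall>j\<in>V. (i, j) \<in> E\<^sup>*)"

end

theory Submission
  imports Defs
begin

text \<open>
  By Gauss's lemma the \<open>g i\<close> are prime in \<open>K[x]\<close>, so a divisor \<open>F\<close> of \<open>f ^ n\<close> with integer-valued
  cofactor has the form \<open>c * \<Prod>i\<in>I. g i ^ k i\<close> with \<open>c \<in> K\<close>.  If \<open>i\<close> and \<open>j\<close> are both quintessential
  for \<open>p\<close>, evaluating at the two witnesses expresses \<open>v\<^sub>p(c)\<close> once through \<open>k i\<close> and once through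
  \<open>k j\<close>, which forces \<open>k i = k j\<close>.  Connectedness makes \<open>k\<close> constant, so \<open>F\<close> is a scalar multiple
  of a power of \<open>f\<close>, and image-primitivity makes the scalar a unit of \<open>D\<close>.  Hence the irreducible
  divisors of \<open>f ^ n\<close> are exactly the associates of \<open>f\<close>.
\<close>

section \<open>Divisibility in principal ideal domains\<close>

lemma module_times: "module ((*) :: 'a::comm_ring_1 \<Rightarrow> 'a \<Rightarrow> 'a)"
  by unfold_locales (auto simp: algebra_simps)

lemma mem_span_singleton: "x \<in> module.span (*) {d} \<longleftrightarrow> d dvd x" for d x :: "'a::comm_ring_1"
  by (auto simp: module.span_singleton[OF module_times] dvd_def mult.commute)

lemma pid_ideal_eq_multiples:
  fixes J :: "'a::idom set"
  assumes "principal_ideal_domain TYPE('a)" "0 \<in> J"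
    and "\<And>x y. x \<in> J \<Longrightarrow> y \<in> J \<Longrightarrow> x + y \<in> J" "\<And>c x. x \<in> J \<Longrightarrow> c * x \<in> J"
  obtains d where "\<And>x. x \<in> J \<longleftrightarrow> d dvd x"
proof -
  have "module.subspace (*) J"
    using assms by (simp add: module.subspace_def[OF module_times])
  then obtain d where "J = module.span (*) {d}"
    using assms(1) unfolding principal_ideal_domain_def by blast
  then have "x \<in> J \<longleftrightarrow> d dvd x" for x
    by (simp add: mem_span_singleton)
  then show thesis by (rule that)
qed

text \<open>Ascending chain condition: along an infinite chain of proper divisors the multiples of
  the \<open>f n\<close> form an ideal, and its generator \<open>d\<close> is already a multiple of
  some \<open>f n\<close>, so the chain would stop there. All inductions over divisors below run
  along this relation.\<close>

lemma pid_wf_proper_dvd: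
  assumes pid: "principal_ideal_domain TYPE('a::idom)"
  shows "wf {(x, y :: 'a). x dvd y \<and> \<not> y dvd x}"
  unfolding wf_iff_no_infinite_down_chain
proof
  assume "\<exists>f. \<forall>i. (f (Suc i), f i) \<in> {(x, y :: 'a). x dvd y \<and> \<not> y dvd x}"
  then obtain f :: "nat \<Rightarrow> 'a"
    where dvd: "\<And>i. f (Suc i) dvd f i" and ndvd: "\<And>i. \<not> f i dvd f (Suc i)"
    by auto
  have chain: "f n dvd f m" if "m \<le> n" for m n
    using that by (induction rule: dec_induct) (auto intro: dvd_trans dvd)
  obtain d where d: "\<And>x. x \<in> {x. \<exists>n. f n dvd x} \<longleftrightarrow> d dvd x"
  proof (rule pid_ideal_eq_multiples[OF pid, of "{x. \<exists>n. f n dvd x}"])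
    fix x y assume "x \<in> {x. \<exists>n. f n dvd x}" "y \<in> {x. \<exists>n. f n dvd x}"
    then obtain m n where "f m dvd x" "f n dvd y" by auto
    then have "f (max m n) dvd x + y"
      by (meson chain dvd_add dvd_trans max.cobounded1 max.cobounded2)
    then show "x + y \<in> {x. \<exists>n. f n dvd x}" by blast
  qed (auto intro: dvd_mult)
  obtain n where "f n dvd d" using d[of d] by auto
  also have "d dvd f (Suc n)" using d[of "f (Suc n)"] dvd_refl by blast
  finally show False using ndvd by blast
qed

text \<open>Bezout: the ideal generated by \<open>p\<close> and \<open>a\<close> is generated by
  some \<open>d\<close>. If \<open>d\<close> is not a unit, irreducibility makes it associated to
  \<open>p\<close>, so \<open>p\<close> divides \<open>a\<close>; otherwise 1 is a combination of
  \<open>p\<close> and \<open>a\<close>.\<close>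

lemma pid_irreducible_imp_prime:
  fixes p :: "'a::idom"
  assumes pid: "principal_ideal_domain TYPE('a)" and irr: "irreducible p"
  shows "prime_elem p"
proof (rule prime_elemI)
  show "p \<noteq> 0" "\<not> p dvd 1" using irr by (auto simp: irreducible_def)
  fix a b assume ab: "p dvd a * b"
  show "p dvd a \<or> p dvd b"
  proof (cases "p dvd a")
    case False
    let ?J = "{x. \<exists>r s. x = r * p + s * a}"
    obtain d where d: "\<And>x. x \<in> ?J \<longleftrightarrow> d dvd x"
    proof (rule pid_ideal_eq_multiples[OF pid, of ?J])
      fix x y assume "x \<in> ?J" "y \<in> ?J"
      then obtain r s r' s' where "x = r * p + s * a" "y = r' * p + s' * a" by auto
      then have "x + y = (r + r') * p + (s + s') * a" by (simp add: algebra_simps)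
      then show "x + y \<in> ?J" by blast
    next
      fix c x assume "x \<in> ?J"
      then obtain r s where "x = r * p + s * a" by auto
      then have "c * x = (c * r) * p + (c * s) * a" by (simp add: algebra_simps)
      then show "c * x \<in> ?J" by blast
    next
      show "0 \<in> ?J" by (auto intro!: exI[of _ 0])
    qed auto
    have "p = 1 * p + 0 * a" "a = 0 * p + 1 * a" by simp_all
    then have "p \<in> ?J" "a \<in> ?J" by blast+
    then have "d dvd p" "d dvd a" by (simp_all only: d)
    then obtain k where k: "p = d * k" by blast
    have "d dvd 1"
    proof (rule ccontr)
      assume "\<not> d dvd 1"
      then have "k dvd 1" using irr k unfolding irreducible_def by blast
      then obtain l where "1 = k * l" by blast
      then have "d = p * l" using k by (metis mult.assoc mult.right_neutral)
      then show False using \<open>d dvd a\<close> False by (meson dvd_def dvd_trans)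
    qed
    then have "1 \<in> ?J" by (simp only: d)
    then obtain r s where "1 = r * p + s * a" by blast
    \<comment> \<open>The Bezout identity multiplied by \<open>b\<close>; \<open>p\<close> divides
      both summands.\<close>
    then have "b = p * (r * b) + s * (a * b)" by (metis mult.assoc mult.commute mult_1 distrib_right)
    then show ?thesis using ab by (metis dvd_add dvd_mult dvd_triv_left)
  qed simp
qed

lemma not_mult_dvd_self:
  fixes a b :: "'a::idom"
  assumes "b \<noteq> 0" "\<not> a dvd 1"
  shows "\<not> a * b dvd b"
proof
  assume "a * b dvd b"
  then obtain c where "b = a * b * c" by blast
  then have "b * 1 = b * (a * c)" by (simp add: mult_ac)
  then have "a * c = 1" by (simp only: mult_left_cancel[OF assms(1)])
  then show False using assms(2) by (metis dvd_triv_left)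
qed

lemma pid_ex_prime_dvd:
  fixes x :: "'a::idom"
  assumes pid: "principal_ideal_domain TYPE('a)" and "x \<noteq> 0" "\<not> x dvd 1"
  shows "\<exists>p. prime_elem p \<and> p dvd x"
  using assms(2,3)
proof (induction x rule: wf_induct_rule[OF pid_wf_proper_dvd[OF pid]])
  case (1 x)
  show ?case
  proof (cases "irreducible x")
    case True
    then have "prime_elem x" by (rule pid_irreducible_imp_prime[OF pid])
    then show ?thesis using dvd_refl[of x] by (intro exI conjI)
  next
    case False
    then obtain a b where ab: "x = a * b" "\<not> a dvd 1" "\<not> b dvd 1"
      using "1.prems" by (auto simp: irreducible_def)
    then have "b \<noteq> 0" using "1.prems" by auto
    then have "(b, x) \<in> {(x, y). x dvd y \<and> \<not> y dvd x}"
      using ab not_mult_dvd_self[of b a] by simp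
    then have "\<exists>p. prime_elem p \<and> p dvd b"
      using \<open>b \<noteq> 0\<close> ab(3) by (rule "1.IH")
    then show ?thesis using ab(1) dvd_mult by blast
  qed
qed

text \<open>A non-unit is \<open>p * y\<close> with \<open>p\<close> prime, and \<open>y\<close> is
  then a proper divisor, so well-foundedness applies. This is the form in which prime factorization
  is used to treat a scalar one prime at a time.\<close>

lemma pid_prime_induct [consumes 2, case_names unit prime_mult]:
  fixes x :: "'a::idom"
  assumes pid: "principal_ideal_domain TYPE('a)" and "x \<noteq> 0"
    and unit: "\<And>x. x dvd 1 \<Longrightarrow> P x"
    and mult: "\<And>p x. prime_elem p \<Longrightarrow> x \<noteq> 0 \<Longrightarrow> P x \<Longrightarrow> P (p * x)"
  shows "P x"
  using assms(2)
proof (induction x rule: wf_induct_rule[OF pid_wf_proper_dvd[OF pid]])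
  case (1 x)
  show ?case
  proof (cases "x dvd 1")
    case False
    then obtain p y where p: "prime_elem p" "x = p * y"
      using pid_ex_prime_dvd[OF pid] "1.prems" by (metis dvdE)
    then have y0: "y \<noteq> 0" using "1.prems" by auto
    then have "(y, x) \<in> {(x, y). x dvd y \<and> \<not> y dvd x}"
      using p not_mult_dvd_self[of y p] by (simp add: prime_elem_def)
    then have "P y" using y0 by (rule "1.IH")
    then show ?thesis unfolding p(2) by (rule mult[OF p(1) y0])
  qed (rule unit)
qed

text \<open>Each division by \<open>p\<close> passes to a proper divisor, so the process stops. For
  prime \<open>p\<close> the exponent \<open>m\<close> is the \<open>p\<close>-adic valuation of
  \<open>x\<close>.\<close>

lemma pid_power_decomp:
  fixes x p :: "'a::idom"
  assumes pid: "principal_ideal_domain TYPE('a)" and "x \<noteq> 0" and p: "\<not> p dvd 1"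
  obtains m y where "x = p ^ m * y" "\<not> p dvd y"
proof -
  have "\<exists>m y. x = p ^ m * y \<and> \<not> p dvd y"
    using assms(2)
  proof (induction x rule: wf_induct_rule[OF pid_wf_proper_dvd[OF pid]])
    case (1 x)
    show ?case
    proof (cases "p dvd x")
      case True
      then obtain y where y: "x = p * y" by blast
      then have "y \<noteq> 0" using "1.prems" by auto
      moreover from this have "(y, x) \<in> {(x, y). x dvd y \<and> \<not> y dvd x}"
        using y p not_mult_dvd_self[of y p] by simp
      ultimately have "\<exists>m z. y = p ^ m * z \<and> \<not> p dvd z" by (rule "1.IH"[rotated])
      then obtain m z where "y = p ^ m * z" "\<not> p dvd z" by blast
      then have "x = p ^ Suc m * z \<and> \<not> p dvd z" using y by (simp add: mult.assoc)
      then show ?thesis by blast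
    qed (auto intro!: exI[of _ 0] exI[of _ x])
  qed
  then show thesis using that by blast
qed

lemma prime_power_decomp_unique:
  fixes p :: "'a::idom"
  assumes eq: "p ^ m * x = p ^ n * y" and "p \<noteq> 0" "\<not> p dvd x" "\<not> p dvd y"
  shows "m = n"
proof -
  have *: "n \<le> m" if "p ^ m * x = p ^ n * y" "\<not> p dvd x" for m n x y
  proof (rule ccontr)
    assume "\<not> n \<le> m"
    then obtain k where "n = m + Suc k" by (metis less_imp_Suc_add not_le add_Suc_right)
    then have "x = p * (p ^ k * y)"
      using that(1) \<open>p \<noteq> 0\<close> by (simp add: power_add mult.assoc)
    then show False using that(2) by auto
  qed
  show ?thesis
    using *[OF eq] *[OF eq[symmetric]] assms by simp
qed

lemma prime_elem_dvd_prod: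
  fixes p :: "'a::comm_semiring_1"
  assumes "prime_elem p" "finite A" "p dvd prod h A"
  shows "\<exists>a\<in>A. p dvd h a"
  using assms(2,3)
proof (induction A rule: finite_induct)
  case empty
  then show ?case using prime_elem_not_unit[OF assms(1)] by simp
next
  case (insert a A)
  then show ?case using prime_elem_dvd_multD[OF assms(1), of "h a" "prod h A"] by auto
qed

section \<open>Irreducible polynomials over the quotient field\<close>

lemma poly_fract_poly [simp]: "poly (fract_poly g) (to_fract w) = to_fract (poly g w)"
  by (induction g) (simp_all add: map_poly_pCons)

lemma fract_poly_prod: "fract_poly (\<Prod>i\<in>A. h i) = (\<Prod>i\<in>A. fract_poly (h i))"
  by (induction A rule: infinite_finite_induct) simp_all

lemma to_fract_prod: "to_fract (\<Prod>i\<in>A. h i) = (\<Prod>i\<in>A. to_fract (h i))"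
  by (induction A rule: infinite_finite_induct) simp_all

lemma to_fract_power: "to_fract (x ^ n) = to_fract x ^ n"
  by (induction n) simp_all

text \<open>Denominators are cleared coefficient by coefficient, collecting their product in
  \<open>d\<close>.\<close>

lemma ex_fract_poly_smult:
  fixes A :: "'a::idom fract poly"
  obtains d B where "d \<noteq> 0" "smult (to_fract d) A = fract_poly B"
proof -
  have "\<exists>d B. d \<noteq> 0 \<and> smult (to_fract d) A = fract_poly B"
  proof (induction A)
    case 0
    show ?case by (intro exI[of _ 1] exI[of _ 0]) simp
  next
    case (pCons a A)
    then obtain d B where d: "d \<noteq> 0" "smult (to_fract d) A = fract_poly B" by blast
    obtain x y where a: "a = to_fract x / to_fract y" "y \<noteq> 0"
      by (metis Fract_conv_to_fract Fract_cases)
    have "smult (to_fract (d * y)) (pCons a A)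
        = pCons (to_fract (d * x)) (smult (to_fract y) (smult (to_fract d) A))"
      using a by (simp add: mult.commute)
    also have "\<dots> = fract_poly (pCons (d * x) (smult y B))"
      by (simp add: d map_poly_pCons)
    finally show ?case using d a by (metis mult_eq_0_iff)
  qed
  then show thesis using that by blast
qed

lemma smult_left_inject:
  fixes a :: "'a::idom"
  shows "a \<noteq> 0 \<Longrightarrow> smult a p = smult a q \<longleftrightarrow> p = q"
  by (simp add: poly_eq_iff)

text \<open>The core of Gauss's lemma: a prime \<open>p\<close> of \<open>D\<close> stays prime as
  the constant \<open>[:p:]\<close> of \<open>D[x]\<close>, so each prime factor of \<open>d\<close>
  can be cancelled from \<open>A\<close> or from \<open>B\<close>, and this leaves degrees
  unchanged.\<close>

lemma smult_eq_mult_cancel: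
  fixes g A B :: "'a::idom poly"
  assumes pid: "principal_ideal_domain TYPE('a)" and "d \<noteq> 0" "smult d g = A * B"
  shows "\<exists>A' B'. g = A' * B' \<and> degree A' = degree A \<and> degree B' = degree B"
  using assms
proof (induction d arbitrary: A B rule: pid_prime_induct)
  case (unit d)
  then obtain u where u: "1 = d * u" by blast
  then have "u \<noteq> 0" by auto
  have "g = smult u (smult d g)" using u by (simp add: mult.commute)
  then have "g = smult u A * B" using unit by simp
  then show ?case using \<open>u \<noteq> 0\<close> by (intro exI[of _ "smult u A"] exI[of _ B]) simp
next
  case (prime_mult p d)
  have p0: "p \<noteq> 0" using prime_mult by (simp add: prime_elem_def)
  have eq: "[:p:] * smult d g = A * B" using prime_mult.prems by (simp add: mult.commute)
  have "prime_elem [:p:]" using prime_mult by (simp add: lift_prime_elem_poly)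
  then have "[:p:] dvd A \<or> [:p:] dvd B"
    using eq by (metis dvd_triv_left prime_elem_dvd_multD)
  then show ?case
  proof
    assume "[:p:] dvd A"
    then obtain C where C: "A = smult p C" by auto
    then have "smult p (smult d g) = smult p (C * B)" using eq by (simp add: mult.commute)
    then have "smult d g = C * B" by (simp only: smult_left_inject[OF p0])
    then show ?thesis using prime_mult.IH[of C B] C p0 by simp
  next
    assume "[:p:] dvd B"
    then obtain C where C: "B = smult p C" by auto
    then have "smult p (smult d g) = smult p (A * C)" using eq by (simp add: mult.commute)
    then have "smult d g = A * C" by (simp only: smult_left_inject[OF p0])
    then show ?thesis using prime_mult.IH[of A C] C p0 by simp
  qed
qed

text \<open>A factorization over \<open>K\<close> becomes, after clearing denominators and
  cancelling the scalar, one over \<open>D\<close> with the same degrees. Irreducibility over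
  \<open>D\<close> makes one factor constant, hence a unit of \<open>K[x]\<close>, where irreducible
  elements are prime.\<close>

lemma irreducible_imp_prime_fract_poly:
  fixes g :: "'a::idom poly"
  assumes pid: "principal_ideal_domain TYPE('a)" and irr: "irreducible g" and deg: "degree g > 0"
  shows "prime_elem (fract_poly g)"
proof (rule field_poly_irreducible_imp_prime, rule irreducibleI)
  show "fract_poly g \<noteq> 0" using deg by auto
  show "\<not> fract_poly g dvd 1"
    using deg \<open>fract_poly g \<noteq> 0\<close> by (auto simp: is_unit_iff_degree degree_map_poly)
  fix A B assume AB: "fract_poly g = A * B"
  then have nz: "A \<noteq> 0" "B \<noteq> 0" using deg by auto
  obtain a A1 where a: "a \<noteq> 0" "smult (to_fract a) A = fract_poly A1" by (rule ex_fract_poly_smult)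
  obtain b B1 where b: "b \<noteq> 0" "smult (to_fract b) B = fract_poly B1" by (rule ex_fract_poly_smult)
  have "fract_poly (smult (a * b) g) = smult (to_fract a) A * smult (to_fract b) B"
    by (simp add: AB mult.commute)
  also have "\<dots> = fract_poly (A1 * B1)" by (simp add: a b)
  finally have "smult (a * b) g = A1 * B1" by (simp only: fract_poly_eq_iff)
  then obtain A' B' where *: "g = A' * B'" "degree A' = degree A1" "degree B' = degree B1"
    using smult_eq_mult_cancel[OF pid, of "a * b" g A1 B1] a b by auto
  have "degree A1 = degree A" "degree B1 = degree B"
    using arg_cong[OF a(2), of degree] arg_cong[OF b(2), of degree] a(1) b(1)
    by (simp_all add: degree_map_poly)
  moreover have "A' dvd 1 \<or> B' dvd 1" using irr * by (simp add: irreducible_def)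
  then have "degree A' = 0 \<or> degree B' = 0" using dvd_imp_degree_le[of _ 1] by fastforce
  ultimately show "A dvd 1 \<or> B dvd 1" using * nz by (auto simp: is_unit_iff_degree)
qed

lemma prime_elem_power_mult_split:
  fixes q :: "'b::idom"
  assumes q: "prime_elem q" and eq: "A * B = q ^ n * X"
  shows "\<exists>k A' B'. k \<le> n \<and> A = q ^ k * A' \<and> B = q ^ (n - k) * B' \<and> A' * B' = X"
  using eq
proof (induction n arbitrary: A B)
  case 0
  then show ?case by auto
next
  case (Suc n)
  have q0: "q \<noteq> 0" using q by (simp add: prime_elem_def)
  have "q dvd A * B" using Suc.prems by simp
  then consider "q dvd A" | "q dvd B" using q by (meson prime_elem_dvd_multD)
  then show ?case
  proof cases
    case 1
    then obtain C where C: "A = q * C" by blast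
    then have "C * B = q ^ n * X" using Suc.prems q0 by (simp add: mult.assoc)
    then obtain k A' B' where "k \<le> n" "C = q ^ k * A'" "B = q ^ (n - k) * B'" "A' * B' = X"
      using Suc.IH by blast
    then show ?thesis using C by (intro exI[of _ "Suc k"] exI[of _ A'] exI[of _ B']) auto
  next
    case 2
    then obtain C where C: "B = q * C" by blast
    then have "A * C = q ^ n * X" using Suc.prems q0 by (simp add: mult.left_commute mult.assoc)
    then obtain k A' B' where "k \<le> n" "A = q ^ k * A'" "C = q ^ (n - k) * B'" "A' * B' = X"
      using Suc.IH by blast
    then show ?thesis using C
      by (intro exI[of _ k] exI[of _ A'] exI[of _ B']) (auto simp: Suc_diff_le mult.assoc)
  qed
qed

text \<open>The powers of the \<open>q i\<close> are distributed over \<open>A\<close> and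
  \<open>B\<close> one index at a time. Different \<open>q i\<close> may be associated, so
  \<open>k\<close> need not be unique; any such \<open>k\<close> suffices later.\<close>

lemma mult_eq_prod_prime_powers:
  fixes q :: "'i \<Rightarrow> 'b::idom"
  assumes "finite I" "\<And>i. i \<in> I \<Longrightarrow> prime_elem (q i)" "A * B = X * (\<Prod>i\<in>I. q i ^ n)"
  shows "\<exists>k A' B'. (\<forall>i\<in>I. k i \<le> n) \<and> A = A' * (\<Prod>i\<in>I. q i ^ k i) \<and>
           B = B' * (\<Prod>i\<in>I. q i ^ (n - k i)) \<and> A' * B' = X"
  using assms
proof (induction I arbitrary: X rule: finite_induct)
  case empty
  then show ?case by auto
next
  case (insert j I)
  have "A * B = (X * q j ^ n) * (\<Prod>i\<in>I. q i ^ n)"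
    using insert by (simp add: mult.assoc)
  then obtain k A' B' where k: "\<forall>i\<in>I. k i \<le> n" "A = A' * (\<Prod>i\<in>I. q i ^ k i)"
      "B = B' * (\<Prod>i\<in>I. q i ^ (n - k i))" "A' * B' = X * q j ^ n"
    using insert.IH[of "X * q j ^ n"] insert.prems by auto
  have "A' * B' = q j ^ n * X" using k(4) by (simp add: mult.commute)
  then obtain l A'' B'' where l: "l \<le> n" "A' = q j ^ l * A''" "B' = q j ^ (n - l) * B''" "A'' * B'' = X"
    using prime_elem_power_mult_split insert.prems by (metis insertI1)
  let ?k = "k(j := l)"
  have same: "(\<Prod>i\<in>I. q i ^ ?k i) = (\<Prod>i\<in>I. q i ^ k i)"
    "(\<Prod>i\<in>I. q i ^ (n - ?k i)) = (\<Prod>i\<in>I. q i ^ (n - k i))"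
    using insert.hyps by (auto intro!: prod.cong)
  show ?case
    using insert.hyps k l same
    by (intro exI[of _ ?k] exI[of _ A''] exI[of _ B'']) (auto simp: mult_ac)
qed

section \<open>Integer-valued polynomials\<close>

lemma int_valuedE:
  assumes "f \<in> int_valued"
  obtains y where "poly f (to_fract w) = to_fract y"
  using assms by (auto simp: int_valued_def)

lemma int_valued_mult: "f \<in> int_valued \<Longrightarrow> h \<in> int_valued \<Longrightarrow> f * h \<in> int_valued"
  by (auto simp: int_valued_def image_iff) (metis to_fract_mult)

lemma int_valued_1: "1 \<in> int_valued"
  by (auto simp: int_valued_def intro: range_eqI[of _ _ 1])

lemma int_valued_power: "f \<in> int_valued \<Longrightarrow> f ^ n \<in> int_valued"
  by (induction n) (auto simp: int_valued_1 int_valued_mult)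

lemma int_valued_prod_mset: "(\<And>a. a \<in># A \<Longrightarrow> a \<in> int_valued) \<Longrightarrow> prod_mset A \<in> int_valued"
  by (induction A) (auto simp: int_valued_1 int_valued_mult)

lemma int_valued_const: "[:to_fract c:] \<in> int_valued"
  by (auto simp: int_valued_def)

lemma degree_units_in:
  fixes S :: "'b::idom poly set"
  assumes "u \<in> units_in S" shows "degree u = 0"
proof -
  obtain v where "u * v = 1" using assms by (auto simp: units_in_def)
  then have "u dvd 1" by (metis dvd_triv_left)
  then show ?thesis using dvd_imp_degree_le[of u 1] by simp
qed

lemma units_in_mult:
  "1 \<in> S \<Longrightarrow> u * v = 1 \<Longrightarrow> u \<in> S \<Longrightarrow> v \<in> S \<Longrightarrow> u \<in> units_in S"
  by (auto simp: units_in_def)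

text \<open>The way in which image-primitivity is exploited: membership in an ideal need only be
  checked on values of \<open>f\<close>.\<close>

lemma ideal_of_values_eq_UNIV:
  assumes "fixed_divisor f = UNIV" "0 \<in> J" "\<And>x y. x \<in> J \<Longrightarrow> y \<in> J \<Longrightarrow> x + y \<in> J"
    and "\<And>c x. x \<in> J \<Longrightarrow> c * x \<in> J" "\<And>a w. poly f (to_fract w) = to_fract a \<Longrightarrow> a \<in> J"
  shows "x \<in> J"
proof -
  have "module.subspace (*) J"
    using assms by (simp add: module.subspace_def[OF module_times])
  then have "fixed_divisor f \<subseteq> J"
    unfolding fixed_divisor_def
    by (rule module.span_minimal[OF module_times, rotated]) (use assms in auto)
  then show ?thesis using assms by auto
qed

text \<open>The scalars carrying every value of \<open>f ^ k\<close> into \<open>D\<close> form an ideal that lies in no maximal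
  ideal, because a prime dividing all values of \<open>f ^ k\<close> divides all values of \<open>f\<close>.\<close>

lemma image_primitive_smult_power:
  fixes f :: "'a::idom fract poly"
  assumes pid: "principal_ideal_domain TYPE('a)" and prim: "image_primitive f"
    and int: "smult c (f ^ k) \<in> int_valued"
  shows "c \<in> range to_fract"
proof -
  define J where "J = {x. c * to_fract x \<in> range to_fract}"
  have fd: "fixed_divisor f = UNIV" and f_int: "f \<in> int_valued"
    using prim by (auto simp: image_primitive_def)
  obtain d where d: "\<And>x. x \<in> J \<longleftrightarrow> d dvd x"
  proof (rule pid_ideal_eq_multiples[OF pid, of J])
    show "0 \<in> J" by (auto simp: J_def intro: range_eqI[of _ _ 0])
    fix x y assume "x \<in> J" "y \<in> J"
    then obtain u v where "c * to_fract x = to_fract u" "c * to_fract y = to_fract v"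
      by (auto simp: J_def)
    then have "c * to_fract (x + y) = to_fract (u + v)" by (simp add: distrib_left)
    then show "x + y \<in> J" by (auto simp: J_def simp del: to_fract_add)
  next
    fix b x assume "x \<in> J"
    then obtain u where "c * to_fract x = to_fract u" by (auto simp: J_def)
    then have "c * to_fract (b * x) = to_fract (b * u)" by (simp add: mult.left_commute)
    then show "b * x \<in> J" by (auto simp: J_def simp del: to_fract_mult)
  qed auto
  have val: "d dvd a ^ k" if "poly f (to_fract w) = to_fract a" for a w
  proof -
    obtain y where "poly (smult c (f ^ k)) (to_fract w) = to_fract y"
      using int by (rule int_valuedE)
    then have "a ^ k \<in> J" using that by (auto simp: J_def poly_power to_fract_power)
    then show ?thesis by (simp add: d)
  qed
  have "d dvd 1"
  proof (rule ccontr)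
    assume nunit: "\<not> d dvd 1"
    \<comment> \<open>For \<open>d = 0\<close> the witness is \<open>p = 0\<close>, since
      \<open>a ^ k = 0\<close> forces \<open>a = 0\<close>. Otherwise \<open>p\<close> is a prime
      divisor of \<open>d\<close>, and it divides \<open>a\<close> as soon as it divides
      \<open>a ^ k\<close>.\<close>
    have "\<exists>p. \<not> p dvd 1 \<and> (\<forall>a w. poly f (to_fract w) = to_fract a \<longrightarrow> p dvd a)"
    proof (cases "d = 0")
      case True
      then show ?thesis using val nunit by (intro exI[of _ 0]) (metis dvd_0_left_iff power_not_zero)
    next
      case False
      then obtain p where "prime_elem p" "p dvd d" using pid_ex_prime_dvd[OF pid] nunit by blast
      then show ?thesis
        using val by (metis dvd_trans prime_elem_def prime_elem_dvd_power)
    qed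
    then obtain p where p: "\<not> p dvd 1" "\<And>a w. poly f (to_fract w) = to_fract a \<Longrightarrow> p dvd a"
      by blast
    have "1 \<in> {x. p dvd x}"
      by (rule ideal_of_values_eq_UNIV[OF fd]) (use p in auto)
    then show False using p by simp
  qed
  then have "1 \<in> J" by (simp only: d)
  then show ?thesis by (simp add: J_def)
qed

section \<open>Valuations and the witnesses of quintessential polynomials\<close>

text \<open>The exponents \<open>n\<close> with \<open>p ^ n\<close> dividing \<open>x\<close> are
  closed downwards. This turns equality of valuations, infinite ones included, into equivalence of
  divisibilities.\<close>

lemma pval_ge_iff: "enat n \<le> pval p x \<longleftrightarrow> p ^ n dvd x"
proof
  assume "p ^ n dvd x"
  then show "enat n \<le> pval p x" unfolding pval_def by (intro SUP_upper) auto
next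
  assume le: "enat n \<le> pval p x"
  show "p ^ n dvd x"
  proof (rule ccontr)
    assume nd: "\<not> p ^ n dvd x"
    have "m \<le> n - 1" if "p ^ m dvd x" for m
      using nd that power_le_dvd[of p m x n] by (cases "n \<le> m") auto
    then have "pval p x \<le> enat (n - 1)"
      unfolding pval_def by (intro SUP_least) auto
    with le have "enat n \<le> enat (n - 1)" by (rule order_trans)
    \<comment> \<open>With truncated subtraction the bound \<open>n - 1\<close> contradicts
      \<open>n\<close> only for positive \<open>n\<close>.\<close>
    moreover have "n \<noteq> 0" using nd by (cases n) auto
    ultimately show False by simp
  qed
qed

lemma pval_eq_0_iff: "pval p x = 0 \<longleftrightarrow> \<not> p dvd x"
  using pval_ge_iff[of 1 p x] by (cases "pval p x") (auto simp: zero_enat_def)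

text \<open>The values of the product are \<open>b\<close> times those of \<open>f\<close>, and the
  latter generate \<open>D\<close>. So \<open>b\<close> generates the fixed divisor of the product
  and may replace the generator \<open>d\<close> of the definition.\<close>

lemma quintessentialD:
  fixes g :: "'i \<Rightarrow> 'a::idom poly"
  assumes q: "quintessential I g p i" and fd: "fixed_divisor f = UNIV"
    and f: "fract_poly (\<Prod>i\<in>I. g i) = smult (to_fract b) f" and int: "f \<in> int_valued"
  shows "p dvd b"
    and "\<exists>w. (\<forall>n. p ^ n dvd poly (g i) w \<longleftrightarrow> p ^ n dvd b) \<and> (\<forall>j\<in>I - {i}. \<not> p dvd poly (g j) w)"
proof -
  obtain d w where d: "fixed_divisor (fract_poly (\<Prod>j\<in>I. g j)) = module.span (*) {d}"
    and pd: "p dvd d" and w: "pval p (poly (g i) w) = pval p d"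
    and w0: "\<forall>j\<in>I - {i}. pval p (poly (g j) w) = 0"
    using q by (auto simp: quintessential_def)
  have val: "poly (fract_poly (\<Prod>j\<in>I. g j)) (to_fract u) = to_fract (b * a)"
    if "poly f (to_fract u) = to_fract a" for u a
    using that by (simp add: f)
  \<comment> \<open>This set is an ideal containing all values of \<open>f\<close>; that it contains
    1 says that \<open>d\<close> divides \<open>b\<close>.\<close>
  have "1 \<in> {x. d dvd b * x}"
  proof (rule ideal_of_values_eq_UNIV[OF fd])
    fix a u assume "poly f (to_fract u) = to_fract a"
    then have "b * a \<in> fixed_divisor (fract_poly (\<Prod>j\<in>I. g j))"
      unfolding fixed_divisor_def
      by (intro module.span_base[OF module_times] CollectI exI[of _ u] val)
    then show "a \<in> {x. d dvd b * x}" by (simp add: d mem_span_singleton)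
  qed (auto simp: distrib_left mult.left_commute)
  then have db: "d dvd b" by simp
  have "fixed_divisor (fract_poly (\<Prod>j\<in>I. g j)) \<subseteq> module.span (*) {b}"
    unfolding fixed_divisor_def
  proof (rule module.span_minimal[OF module_times])
    show "module.subspace (*) (module.span (*) {b})"
      by (rule module.subspace_span[OF module_times])
    show "{a. \<exists>w. poly (fract_poly (\<Prod>j\<in>I. g j)) (to_fract w) = to_fract a} \<subseteq> module.span (*) {b}"
    proof safe
      fix a u assume a: "poly (fract_poly (\<Prod>j\<in>I. g j)) (to_fract u) = to_fract a"
      obtain y where "poly f (to_fract u) = to_fract y" using int by (rule int_valuedE)
      then have "a = b * y" using val a by (metis to_fract_eq_iff)
      then show "a \<in> module.span (*) {b}" by (simp add: mem_span_singleton)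
    qed
  qed
  then have "b dvd d" using d by (metis dvd_refl mem_span_singleton subsetD)
  then have "p ^ n dvd poly (g i) w \<longleftrightarrow> p ^ n dvd b" for n
    using db w by (metis dvd_trans pval_ge_iff)
  then show "\<exists>w. (\<forall>n. p ^ n dvd poly (g i) w \<longleftrightarrow> p ^ n dvd b) \<and> (\<forall>j\<in>I - {i}. \<not> p dvd poly (g j) w)"
    using w0 by (intro exI[of _ w]) (simp add: pval_eq_0_iff)
  show "p dvd b" using pd db by (rule dvd_trans)
qed

section \<open>Divisors of powers of the given polynomial\<close>

text \<open>At a witness for \<open>i\<close>, the value of \<open>f\<close> is prime to \<open>p\<close>, hence so is the value of every
  divisor of \<open>f ^ n\<close>.  All the other factors being prime to \<open>p\<close> as well, the scalar \<open>c\<close> must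
  compensate \<open>p ^ (m * k i)\<close> exactly, so \<open>m * k i\<close> is the same for all vertices \<open>i\<close> that are
  quintessential for \<open>p\<close>.\<close>

lemma quintessential_value:
  fixes g :: "'i \<Rightarrow> 'a::idom poly"
  assumes p: "prime_elem p" and q: "quintessential I g p i" and prim: "image_primitive f"
    and f: "fract_poly (\<Prod>i\<in>I. g i) = smult (to_fract b) f"
    and b: "b = p ^ m * b'" "\<not> p dvd b'" and I: "finite I" "i \<in> I"
    and F: "F \<in> int_valued" "G \<in> int_valued" "F * G = f ^ n"
    and F_eq: "F = smult c (\<Prod>i\<in>I. fract_poly (g i) ^ k i)"
  shows "\<exists>y s. to_fract y = c * to_fract (p ^ (m * k i) * s) \<and> \<not> p dvd y \<and> \<not> p dvd s"
proof -
  have fd: "fixed_divisor f = UNIV" and int: "f \<in> int_valued"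
    using prim by (auto simp: image_primitive_def)
  have p0: "p \<noteq> 0" using p by (simp add: prime_elem_def)
  obtain w where w: "\<forall>n. p ^ n dvd poly (g i) w \<longleftrightarrow> p ^ n dvd b"
    "\<forall>j\<in>I - {i}. \<not> p dvd poly (g j) w"
    using quintessentialD(2)[OF q fd f int] by (elim exE conjE) (rule that)
  have "p ^ m dvd poly (g i) w" unfolding w(1)[rule_format] b(1) by (rule dvd_triv_left)
  then obtain r where r: "poly (g i) w = p ^ m * r" by blast
  \<comment> \<open>The witness property at exponent \<open>Suc m\<close>: \<open>p ^ m\<close> is
    the exact power of \<open>p\<close> in \<open>g i\<close> at \<open>w\<close>, as it is in
    \<open>b\<close>.\<close>
  have "\<not> p dvd r"
  proof
    assume "p dvd r"
    then have "p ^ Suc m dvd poly (g i) w" unfolding r power_Suc2 by (rule mult_dvd_mono[OF dvd_refl])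
    then have "p ^ Suc m dvd b" unfolding w(1)[rule_format] .
    then have "p ^ m * p dvd p ^ m * b'" unfolding b(1) power_Suc2 .
    then have "p dvd b'" using p0 by (simp only: dvd_mult_cancel_left) simp
    then show False using b(2) by simp
  qed
  let ?R = "\<Prod>j\<in>I-{i}. poly (g j) w" and ?S = "\<Prod>j\<in>I-{i}. poly (g j) w ^ k j"
  have "\<not> p dvd ?R"
    using prime_elem_dvd_prod[OF p, of "I - {i}" "\<lambda>j. poly (g j) w"] w(2) I by blast
  have "\<not> p dvd ?S"
    using prime_elem_dvd_prod[OF p, of "I - {i}" "\<lambda>j. poly (g j) w ^ k j"] w(2) I
      prime_elem_dvd_power[OF p] by blast
  obtain a where a: "poly f (to_fract w) = to_fract a" using int by (rule int_valuedE)
  obtain y where y: "poly F (to_fract w) = to_fract y" using F(1) by (rule int_valuedE)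
  obtain z where z: "poly G (to_fract w) = to_fract z" using F(2) by (rule int_valuedE)
  have "to_fract (\<Prod>j\<in>I. poly (g j) w) = poly (fract_poly (\<Prod>j\<in>I. g j)) (to_fract w)"
    by (simp add: poly_prod)
  also have "\<dots> = to_fract (b * a)" by (simp add: f a)
  finally have "(\<Prod>j\<in>I. poly (g j) w) = b * a" by (simp only: to_fract_eq_iff)
  moreover have "(\<Prod>j\<in>I. poly (g j) w) = p ^ m * (r * ?R)"
    unfolding prod.remove[OF I] r by (simp only: mult.assoc)
  ultimately have "p ^ m * (b' * a) = p ^ m * (r * ?R)"
    unfolding b(1) by (simp only: mult.assoc)
  \<comment> \<open>The factor \<open>g i\<close> absorbs exactly the power of \<open>p\<close> in
    the denominator, so no \<open>p\<close> is left for the value \<open>a\<close> of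
    \<open>f\<close>.\<close>
  then have "b' * a = r * ?R" using p0 by simp
  moreover have "\<not> p dvd r * ?R"
    using \<open>\<not> p dvd r\<close> \<open>\<not> p dvd ?R\<close> prime_elem_dvd_multD[OF p] by blast
  ultimately have "\<not> p dvd a" using dvd_mult[of p a b'] by argo
  have "to_fract (y * z) = to_fract (a ^ n)"
    using arg_cong[OF F(3), of "\<lambda>h. poly h (to_fract w)"] y z a
    by (simp add: poly_power to_fract_power)
  then have "y * z = a ^ n" by (simp only: to_fract_eq_iff)
  then have "\<not> p dvd y"
    using \<open>\<not> p dvd a\<close> prime_elem_dvd_power[OF p, of a n] dvd_mult2[of p y z] by argo
  have val: "(\<Prod>j\<in>I. poly (g j) w ^ k j) = p ^ (m * k i) * (r ^ k i * ?S)"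
    unfolding prod.remove[OF I] r by (simp only: power_mult_distrib power_mult mult.assoc)
  have "to_fract y = c * to_fract (\<Prod>j\<in>I. poly (g j) w ^ k j)"
    using y by (simp add: F_eq poly_prod to_fract_prod to_fract_power)
  then have "to_fract y = c * to_fract (p ^ (m * k i) * (r ^ k i * ?S))" by (simp only: val)
  moreover have "\<not> p dvd r ^ k i * ?S"
    using \<open>\<not> p dvd r\<close> \<open>\<not> p dvd ?S\<close> prime_elem_dvd_multD[OF p] prime_elem_dvd_power[OF p] by blast
  ultimately show ?thesis using \<open>\<not> p dvd y\<close> by blast
qed

text \<open>Once \<open>k\<close> is constant, \<open>F\<close> and its cofactor are scalar
  multiples \<open>u\<close> and \<open>v\<close> of complementary powers of \<open>f\<close>. Then
  \<open>u * v = 1\<close>, and both scalars lie in \<open>D\<close> by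
  \<open>image_primitive_smult_power\<close>, so \<open>[:u:]\<close> is a unit.\<close>

lemma divisor_of_power_associated:
  fixes g :: "'i \<Rightarrow> 'a::idom poly"
  assumes pid: "principal_ideal_domain TYPE('a)" and prim: "image_primitive f"
    and f: "fract_poly (\<Prod>i\<in>I. g i) = smult (to_fract b) f" and b0: "b \<noteq> 0"
    and I: "finite I" and g: "\<And>i. i \<in> I \<Longrightarrow> prime_elem (fract_poly (g i))"
    and conn: "graph_connected I (quintessential_edges I g)"
    and F: "F \<in> int_valued" "G \<in> int_valued" "F * G = f ^ n"
  shows "\<exists>k. associated_in int_valued F (f ^ k)"
proof -
  let ?q = "\<lambda>i. fract_poly (g i)"
  have fd: "fixed_divisor f = UNIV" and int: "f \<in> int_valued"
    using prim by (auto simp: image_primitive_def)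
  have prod_q: "(\<Prod>i\<in>I. ?q i) = smult (to_fract b) f" using f by (simp add: fract_poly_prod)
  have q0: "?q i \<noteq> 0" if "i \<in> I" for i using g[OF that] by (simp add: prime_elem_def)
  have "(\<Prod>i\<in>I. ?q i) \<noteq> 0" using I q0 by simp
  then have f0: "f \<noteq> 0" using prod_q by auto
  have "f = smult (1 / to_fract b) (\<Prod>i\<in>I. ?q i)" using b0 prod_q by simp
  then have "F * G = [:(1 / to_fract b) ^ n:] * (\<Prod>i\<in>I. ?q i ^ n)"
    using F(3) by (simp add: smult_power prod_power_distrib)
  from mult_eq_prod_prime_powers[OF I g this]
  obtain k A B where k: "\<And>i. i \<in> I \<Longrightarrow> k i \<le> n" and A: "F = A * (\<Prod>i\<in>I. ?q i ^ k i)"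
    and B: "G = B * (\<Prod>i\<in>I. ?q i ^ (n - k i))" and AB: "A * B = [:(1 / to_fract b) ^ n:]"
    by blast
  have nz: "A \<noteq> 0" "B \<noteq> 0" using AB b0 by auto
  have "degree A + degree B = 0" using degree_mult_eq[OF nz] AB by simp
  then obtain c where c: "A = [:c:]" by (metis add_is_0 degree_eq_zeroE)
  have c0: "c \<noteq> 0" using nz c by auto
  have F_eq: "F = smult c (\<Prod>i\<in>I. ?q i ^ k i)" using A c by simp
  have edge: "k i = k j" if ij_edge: "(i, j) \<in> quintessential_edges I g" for i j
  proof -
    obtain p where ij: "i \<in> I" "j \<in> I" and p: "prime_elem p"
      and qi: "quintessential I g p i" and qj: "quintessential I g p j"
      using ij_edge unfolding quintessential_edges_def by blast
    have p0: "p \<noteq> 0" "\<not> p dvd 1" using p by (auto simp: prime_elem_def)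
    obtain m b' where mb: "b = p ^ m * b'" "\<not> p dvd b'"
      using pid_power_decomp[OF pid b0 p0(2)] .
    have "p dvd b" by (rule quintessentialD(1)[OF qi fd f int])
    then have "m > 0" using mb by (cases m) auto
    obtain y s where y: "to_fract y = c * to_fract (p ^ (m * k i) * s)" "\<not> p dvd y" "\<not> p dvd s"
      using quintessential_value[OF p qi prim f mb I ij(1) F F_eq] by blast
    obtain y' s' where y': "to_fract y' = c * to_fract (p ^ (m * k j) * s')" "\<not> p dvd y'" "\<not> p dvd s'"
      using quintessential_value[OF p qj prim f mb I ij(2) F F_eq] by blast
    \<comment> \<open>The unknown scalar \<open>c\<close> is eliminated by multiplying each equation
      with the value from the other witness; what remains besides the powers of \<open>p\<close> is
      prime to \<open>p\<close>.\<close>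
    have "c * to_fract (p ^ (m * k i) * (s * y')) = to_fract y * to_fract y'" by (simp add: y(1))
    also have "\<dots> = c * to_fract (p ^ (m * k j) * (s' * y))" by (simp add: y'(1) mult_ac)
    finally have "to_fract (p ^ (m * k i) * (s * y')) = to_fract (p ^ (m * k j) * (s' * y))"
      by (simp only: mult_left_cancel[OF c0])
    then have "p ^ (m * k i) * (s * y') = p ^ (m * k j) * (s' * y)" by (simp only: to_fract_eq_iff)
    moreover have "\<not> p dvd s * y'" "\<not> p dvd s' * y"
      using y y' p by (auto dest: prime_elem_dvd_multD)
    ultimately have "m * k i = m * k j" using p0 by (metis prime_power_decomp_unique)
    then show ?thesis using \<open>m > 0\<close> by simp
  qed
  have path: "k i = k j" if "(i, j) \<in> (quintessential_edges I g)\<^sup>*" for i j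
    using that by (induction rule: rtrancl_induct) (auto dest: edge)
  obtain i0 where i0: "i0 \<in> I" and "\<And>i. i \<in> I \<Longrightarrow> (i0, i) \<in> (quintessential_edges I g)\<^sup>*"
    using conn by (auto simp: graph_connected_def)
  then have const: "k i = k i0" if "i \<in> I" for i using path that by metis
  let ?k = "k i0"
  have "F = smult c ((\<Prod>i\<in>I. ?q i) ^ ?k)"
    unfolding F_eq prod_power_distrib by (simp add: const cong: prod.cong)
  then have F': "F = smult (c * to_fract b ^ ?k) (f ^ ?k)" by (simp add: prod_q smult_power)
  have "G = B * (\<Prod>i\<in>I. ?q i) ^ (n - ?k)"
    unfolding B prod_power_distrib by (simp add: const cong: prod.cong)
  moreover obtain c' where "B = [:c':]"
    using \<open>degree A + degree B = 0\<close> by (metis add_is_0 degree_eq_zeroE)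
  ultimately have G': "G = smult (c' * to_fract b ^ (n - ?k)) (f ^ (n - ?k))"
    by (simp add: prod_q smult_power mult.commute)
  define u v where "u = c * to_fract b ^ ?k" and "v = c' * to_fract b ^ (n - ?k)"
  have "?k \<le> n" using k i0 .
  then have "f ^ ?k * f ^ (n - ?k) = f ^ n" by (simp add: power_add[symmetric])
  then have "smult (u * v) (f ^ n) = F * G"
    by (simp add: F' G' u_def v_def mult.commute)
  then have "smult (u * v - 1) (f ^ n) = 0" using F(3) by (simp add: smult_diff_left)
  then have uv: "u * v = 1" using f0 by simp
  obtain x where x: "u = to_fract x"
    using image_primitive_smult_power[OF pid prim] F(1) F' u_def by blast
  obtain x' where x': "v = to_fract x'"
    using image_primitive_smult_power[OF pid prim] F(2) G' v_def by blast
  have "[:u:] * [:v:] = 1" using uv by (simp add: one_pCons mult.commute)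
  then have "[:u:] \<in> units_in int_valued"
    using int_valued_1 int_valued_const x x' by (intro units_in_mult[of _ _ "[:v:]"]) auto
  then show ?thesis
    unfolding associated_in_def using F' u_def
    by (intro exI[of _ ?k] bexI[of _ "[:u:]"]) auto
qed

section \<open>From divisors of powers to absolute irreducibility\<close>

text \<open>Units have degree 0, so degrees control exponents. The case \<open>n = 1\<close> of
  \<open>assoc\<close> yields irreducibility of \<open>f\<close>; the general case shows that
  irreducible factors of \<open>f ^ n\<close> are associated to \<open>f\<close>, and degrees then
  count them.\<close>

lemma absolutely_irreducibleI:
  fixes f :: "'a::idom fract poly"
  assumes f: "f \<in> int_valued" and deg: "degree f > 0"
    and assoc: "\<And>n F G. F \<in> int_valued \<Longrightarrow> G \<in> int_valued \<Longrightarrow> F * G = f ^ n \<Longrightarrow>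
      \<exists>k. associated_in int_valued F (f ^ k)"
  shows "absolutely_irreducible_in int_valued f"
proof -
  let ?R = "int_valued :: 'a fract poly set"
  have f0: "f \<noteq> 0" using deg by auto
  have nunit: "f \<notin> units_in ?R" using degree_units_in deg by fastforce
  have irr: "irreducible_in ?R f"
    unfolding irreducible_in_def
  proof (intro conjI ballI impI f f0 nunit)
    fix a b assume ab: "a \<in> ?R" "b \<in> ?R" "f = a * b"
    then have nz: "a \<noteq> 0" "b \<noteq> 0" using f0 by auto
    obtain k u where u: "u \<in> units_in ?R" "a = u * f ^ k"
      using assoc[of a b 1] ab by (auto simp: associated_in_def)
    obtain v where v: "v \<in> ?R" "u * v = 1" "u \<in> ?R" using u by (auto simp: units_in_def)
    have "u \<noteq> 0" using v by auto
    then have "degree a = k * degree f"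
      using u degree_units_in[OF u(1)] f0 by (simp add: degree_mult_eq degree_power_eq)
    moreover have "degree a + degree b = degree f" using nz ab by (simp add: degree_mult_eq)
    ultimately have "k * degree f \<le> degree f" by linarith
    then have "k \<le> 1" using deg by simp
    then have "k = 0 \<or> k = 1" by auto
    then show "a \<in> units_in ?R \<or> b \<in> units_in ?R"
    proof
      assume "k = 1"
      then have "f * (u * b) = (u * f ^ k) * b" by (simp add: mult_ac)
      also have "\<dots> = f * 1" using u(2) ab(3) by (simp only: mult_1_right)
      finally have "f * (u * b) = f * 1" .
      then have "u * b = 1" by (simp only: mult_left_cancel[OF f0])
      then have "b * u = 1" by (simp only: mult.commute)
      then show ?thesis using units_in_mult[OF int_valued_1] ab(2) v(3) by blast
    qed (use u in auto)
  qed
  have factor: "associated_in ?R a f" if a: "irreducible_in ?R a" and b: "b \<in> ?R" "a * b = f ^ n" for a b n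
  proof -
    have aR: "a \<in> ?R" and an: "a \<notin> units_in ?R" using a by (auto simp: irreducible_in_def)
    obtain k u where u: "u \<in> units_in ?R" "a = u * f ^ k"
      using assoc[OF aR b] by (auto simp: associated_in_def)
    obtain v where v: "u * v = 1" "u \<in> ?R" using u by (auto simp: units_in_def)
    have "u \<noteq> 0" using v by auto
    have "k \<noteq> 0" using u an by (cases k) auto
    then obtain l where l: "k = Suc l" by (cases k) auto
    \<comment> \<open>Irreducibility applied to \<open>a = (u * f) * f ^ l\<close>; by degree the
      first factor is not a unit, and the second is one only for \<open>l = 0\<close>.\<close>
    have "u * f \<in> units_in ?R \<or> f ^ l \<in> units_in ?R"
      using a u v l f int_valued_mult int_valued_power unfolding irreducible_in_def
      by (metis mult.assoc power_Suc)
    moreover have "degree (u * f) = degree f" "degree (f ^ l) = l * degree f"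
      using f0 \<open>u \<noteq> 0\<close> degree_units_in[OF u(1)] by (simp_all add: degree_mult_eq degree_power_eq)
    ultimately have "l = 0" using deg degree_units_in by fastforce
    then show ?thesis using u l by (auto simp: associated_in_def)
  qed
  \<comment> \<open>The degree is carried through the induction because it later identifies
    \<open>size A\<close> with \<open>n\<close>.\<close>
  have same: "rel_mset (associated_in ?R) A (replicate_mset (size A) f) \<and>
      degree (prod_mset A) = size A * degree f"
    if "\<And>a. a \<in># A \<Longrightarrow> associated_in ?R a f" for A
    using that
  proof (induction A)
    case empty
    then show ?case by (simp add: rel_mset_Zero)
  next
    case (add a A)
    then obtain u where u: "u \<in> units_in ?R" "a = u * f" by (auto simp: associated_in_def)
    then have "u \<noteq> 0" by (auto simp: units_in_def)
    \<comment> \<open>Excludes 0 from the factors, so that degrees add up.\<close>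
    have "\<not> associated_in ?R 0 f" using f0 by (auto simp: associated_in_def units_in_def)
    then have "prod_mset A \<noteq> 0" using add.prems[of 0] by auto
    then show ?case
      using add u \<open>u \<noteq> 0\<close> f0 degree_units_in[OF u(1)]
      by (auto intro!: rel_mset_Plus simp: degree_mult_eq)
  qed
  show ?thesis
    unfolding absolutely_irreducible_in_def factorization_in_def essentially_same_in_def
  proof (intro conjI allI impI irr; elim conjE)
    fix n A assume irrA: "\<forall>a\<in>#A. irreducible_in ?R a" and prodA: "prod_mset A = f ^ n"
    have "associated_in ?R a f" if "a \<in># A" for a
    proof (rule factor)
      show "irreducible_in ?R a" using irrA that by blast
      show "prod_mset (A - {#a#}) \<in> ?R"
        using irrA by (intro int_valued_prod_mset) (auto simp: irreducible_in_def dest: in_diffD)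
      show "a * prod_mset (A - {#a#}) = f ^ n"
        using arg_cong[OF insert_DiffM[OF that], of prod_mset] prodA by simp
    qed
    then have *: "rel_mset (associated_in ?R) A (replicate_mset (size A) f)"
        "size A * degree f = n * degree f"
      using same[of A] prodA f0 by (auto simp: degree_power_eq)
    then show "rel_mset (associated_in ?R) A (replicate_mset n f)" using deg by auto
  qed
qed

text \<open>A constant divides all its coefficients, so a primitive one is a unit. Constants have to
  be excluded because the non-zero ones become units of \<open>K[x]\<close>.\<close>

lemma degree_pos_of_primitive_irreducible:
  fixes g :: "'a::idom poly"
  assumes "primitive_poly g" "irreducible g"
  shows "degree g > 0"
proof (rule ccontr)
  assume "\<not> degree g > 0"
  then obtain c where c: "g = [:c:]" by (metis degree_eq_zeroE gr0I)
  then have "\<forall>n. c dvd coeff g n" by (simp add: coeff_pCons split: nat.split)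
  then have "c dvd 1" using assms(1) unfolding primitive_poly_def by blast
  then have "g dvd 1" using c by (simp add: is_unit_const_poly_iff)
  then show False using assms(2) by (simp add: irreducible_def)
qed

theorem theorem2:
  fixes f :: "'a::idom fract poly"
    and g :: "'i \<Rightarrow> 'a poly"
    and I :: "'i set"
    and T :: "'a set"
    and e :: "'a \<Rightarrow> nat"
  assumes pid: "principal_ideal_domain TYPE('a)"
    and f_int: "f \<in> int_valued"
    and f_nonconst: "degree f > 0"
    and f_image_primitive: "image_primitive f"
    and I: "finite I" "I \<noteq> {}"
    and g: "\<And>i. i \<in> I \<Longrightarrow> primitive_poly (g i)" "\<And>i. i \<in> I \<Longrightarrow> irreducible (g i)"
    and T: "finite T" "\<And>p. p \<in> T \<Longrightarrow> prime_elem p"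
    and T_nonassoc:
      "\<And>p q. p \<in> T \<Longrightarrow> q \<in> T \<Longrightarrow> p \<noteq> q \<Longrightarrow> \<not> associated_in UNIV p q"
    and f_eq: "f = smult (1 / to_fract (\<Prod>p\<in>T. p ^ e p)) (fract_poly (\<Prod>i\<in>I. g i))"
    and connected: "graph_connected I (quintessential_edges I g)"
  shows "absolutely_irreducible_in int_valued f"
proof (rule absolutely_irreducibleI[OF f_int f_nonconst])
  fix n F G assume FG: "F \<in> int_valued" "G \<in> int_valued" "F * G = f ^ n"
  define b where "b = (\<Prod>p\<in>T. p ^ e p)"
  have b0: "b \<noteq> 0" using T by (auto simp: b_def prime_elem_def)
  have f': "fract_poly (\<Prod>i\<in>I. g i) = smult (to_fract b) f"
    using b0 f_eq by (simp add: b_def)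
  have prime: "prime_elem (fract_poly (g i))" if "i \<in> I" for i
    using irreducible_imp_prime_fract_poly[OF pid] degree_pos_of_primitive_irreducible g that by blast
  show "\<exists>k. associated_in int_valued F (f ^ k)"
    by (rule divisor_of_power_associated[OF pid f_image_primitive f' b0 I(1) prime connected FG])
qed

end
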